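(* Consider a two-agent factored multi-agent MDP with finite joint state set $S=S_1\times S_2$, joint action set $A=A_1\times A_2$, transition function $T$, joint policy $\boldsymbol{\pi}=\langle\pi_1,\pi_2\rangle$, induced distribution $p^{\boldsymbol{\pi}}$, total (extrinsic plus intrinsic) reward $\tilde r_2$ of agent 2, value function $V_2^{\boldsymbol{\pi}}$ of agent 2 and discount factor $\gamma$, as in the context. Let the Value of Interaction of agent 1 on agent 2 be defined by $$VoI_{2|1}^{\boldsymbol{\pi}}(S_2';S_1,A_1|S_2,A_2)=\sum_{\boldsymbol{s}\in S,\ \boldsymbol{a}\in A,\ s_2'\in S_2}p^{\boldsymbol{\pi}}(\boldsymbol{s},\boldsymbol{a},s_2')\left[Q_2^{\boldsymbol{\pi}}(\boldsymbol{s},\boldsymbol{a},s_2')-Q_{2|1}^{\boldsymbol{\pi},*}(s_2,a_2,s_2')\right],$$ where $$Q_2^{\boldsymbol{\pi}}(\boldsymbol{s},\boldsymbol{a},s_2')=\tilde r_2(\boldsymbol{s},\boldsymbol{a})+\gamma\sum_{s_1'}p(s_1'|\boldsymbol{s},\boldsymbol{a},s_2')\,V_2^{\boldsymbol{\pi}}(\boldsymbol{s}'),$$ $$Q_{2|1}^{\boldsymbol{\pi},*}(s_2,a_2,s_2')=\sum_{s_1^*,a_1^*}p^{\boldsymbol{\pi}}(s_1^*,a_1^*|s_2,a_2)\Big[\tilde r_2(s_1^*,s_2,a_1^*,a_2)+\gamma\sum_{s_1'}p(s_1'|s_1^*,s_2,a_1^*,a_2,s_2')\,V_2^{\boldsymbol{\pi}}(\boldsymbol{s}')\Big].$$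 Then $$VoI_{2|1}^{\boldsymbol{\pi}}(S_2';S_1,A_1|S_2,A_2)=\mathbb{E}_\tau\left[\tilde r_2(\boldsymbol{s},\boldsymbol{a})-\tilde r_2^{\boldsymbol{\pi}}(s_2,a_2)+\gamma\left(1-\frac{p^{\boldsymbol{\pi}}(s_2'|s_2,a_2)}{p(s_2'|\boldsymbol{s},\boldsymbol{a})}\right)V_2^{\boldsymbol{\pi}}(\boldsymbol{s}')\right],$$ where $\tilde r_2^{\boldsymbol{\pi}}(s_2,a_2)=\sum_{s_1^*,a_1^*}p^{\boldsymbol{\pi}}(s_1^*,a_1^*|s_2,a_2)\,\tilde r_2(s_1^*,s_2,a_1^*,a_2)$ is the counterfactual immediate reward.
   Context: Setting: two cooperative agents; $S_i$ and $A_i$ are the state set and action set of agent $i$. Write $\boldsymbol{s}=(s_1,s_2)$, $\boldsymbol{a}=(a_1,a_2)$, $\boldsymbol{s}'=(s_1',s_2')$. In state $\boldsymbol{s}$ under joint action $\boldsymbol{a}$ the next state is drawn from $T(\boldsymbol{s}'|\boldsymbol{s},\boldsymbol{a})$ and a shared extrinsic reward $r(\boldsymbol{s},\boldsymbol{a})$ is received. Each agent $i$ has a stochastic policy $\pi_i(a_i|s_i)$. In the expression $VoI_{2|1}^{\boldsymbol{\pi}}(S_2';S_1,A_1|S_2,A_2)$ the symbols $S_i,A_i$ denote the random variables of state and action of agent $i$ under the distribution induced by $\boldsymbol{\pi}$, and $S_2'$ the next state of agent 2. Rewards and values: $\tilde r_2(\boldsymbol{s},\boldsymbol{a})=r(\boldsymbol{s},\boldsymbol{a})+u_2(s_2,a_2)$,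 where $u_2$ is a curiosity-derived intrinsic reward of agent 2. $V_2^{\boldsymbol{\pi}}(\boldsymbol{s})=V^{ext,\boldsymbol{\pi}}(\boldsymbol{s})+V_2^{int,\boldsymbol{\pi}}(\boldsymbol{s})$ is the sum of the extrinsic value function and the intrinsic value function of agent 2 under $\boldsymbol{\pi}$. $\gamma$ is the discount factor. Probabilities: $p^{\boldsymbol{\pi}}(\boldsymbol{s},\boldsymbol{a})$ is the joint state-action distribution induced by $\boldsymbol{\pi}$. The other probabilities are the marginals and conditionals of the law in which $(\boldsymbol{s},\boldsymbol{a})\sim p^{\boldsymbol{\pi}}$ and $\boldsymbol{s}'\sim T(\cdot|\boldsymbol{s},\boldsymbol{a})$: - $p(s_2'|\boldsymbol{s},\boldsymbol{a})=\sum_{s_1'}T(s_1',s_2'|\boldsymbol{s},\boldsymbol{a})$; - $p^{\boldsymbol{\pi}}(\boldsymbol{s},\boldsymbol{a},s_2')=p^{\boldsymbol{\pi}}(\boldsymbol{s},\boldsymbol{a})\,p(s_2'|\boldsymbol{s},\boldsymbol{a})$; - $p(s_1'|\boldsymbol{s},\boldsymbol{a},s_2')=T(s_1',s_2'|\boldsymbol{s},\boldsymbol{a})/p(s_2'|\boldsymbol{s},\boldsymbol{a})$; - $p^{\boldsymbol{\pi}}(s_1^*,a_1^*|s_2,a_2)=p^{\boldsymbol{\pi}}(s_1^*,s_2,a_1^*,a_2)/\sum_{s_1,a_1}p^{\boldsymbol{\pi}}(s_1,s_2,a_1,a_2)$; - $p^{\boldsymbol{\pi}}(s_2'|s_2,a_2)=\sum_{s_1^*,a_1^*}p^{\boldsymbol{\pi}}(s_1^*,a_1^*|s_2,a_2)\,p(s_2'|s_1^*,s_2,a_1^*,a_2)$.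 Expectation: $\mathbb{E}_\tau$ is the expectation over state-action trajectories under $\boldsymbol{\pi}$, i.e. $(\boldsymbol{s},\boldsymbol{a})\sim p^{\boldsymbol{\pi}}$ and then $\boldsymbol{s}'\sim T(\cdot|\boldsymbol{s},\boldsymbol{a})$. *)

theory Defs
  imports "HOL-Probability.Probability"
begin

text \<open>
  A two-agent factored MDP with agents indexed 1 and 2. The state and action sets of the agents are
  finite types, and transitions are joint: the next state of either agent may depend on both agents.

  The fields \<open>init\<close> and \<open>sample_time\<close> say which trajectory distribution a policy induces: the
  initial state is drawn from \<open>init\<close>, and a state-action pair is read off the trajectory at an
  independent random time drawn from \<open>sample_time\<close>. A geometric time gives the normalized discounted
  visitation distribution, a uniform time on \<open>{..<H}\<close> the average over a horizon \<open>H\<close>, and a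
  stationary \<open>init\<close> gives the stationary distribution whatever the time.

  The curiosity-derived intrinsic reward \<open>intrinsic\<close> of agent 2 is an arbitrary function of that
  agent's own state and action.
\<close>

record ('s1, 's2, 'a1, 'a2) factored_mdp =
  trans :: "'s1 \<times> 's2 \<Rightarrow> 'a1 \<times> 'a2 \<Rightarrow> ('s1 \<times> 's2) pmf"
  reward :: "'s1 \<times> 's2 \<Rightarrow> 'a1 \<times> 'a2 \<Rightarrow> real"
  intrinsic :: "'s2 \<Rightarrow> 'a2 \<Rightarrow> real"
  discount :: real
  init :: "('s1 \<times> 's2) pmf"
  sample_time :: "nat pmf"

type_synonym ('s1, 's2, 'a1, 'a2) policy = "('s1 \<Rightarrow> 'a1 pmf) \<times> ('s2 \<Rightarrow> 'a2 pmf)"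

definition joint_policy ::
  "('s1, 's2, 'a1, 'a2) policy \<Rightarrow> 's1 \<times> 's2 \<Rightarrow> ('a1 \<times> 'a2) pmf" where
  "joint_policy \<pi> s = pair_pmf (fst \<pi> (fst s)) (snd \<pi> (snd s))"

text \<open>Law of the state at a given time when the initial state has law \<open>\<mu>\<close>.\<close>

primrec state_at ::
  "('s1, 's2, 'a1, 'a2) factored_mdp \<Rightarrow> ('s1, 's2, 'a1, 'a2) policy \<Rightarrow> ('s1 \<times> 's2) pmf
    \<Rightarrow> nat \<Rightarrow> ('s1 \<times> 's2) pmf" where
  "state_at M \<pi> \<mu> 0 = \<mu>"
| "state_at M \<pi> \<mu> (Suc t) =
     bind_pmf (state_at M \<pi> \<mu> t) (\<lambda>s. bind_pmf (joint_policy \<pi> s) (\<lambda>a. trans M s a))"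

definition add_action ::
  "('s1, 's2, 'a1, 'a2) policy \<Rightarrow> ('s1 \<times> 's2) pmf \<Rightarrow> (('s1 \<times> 's2) \<times> ('a1 \<times> 'a2)) pmf" where
  "add_action \<pi> \<mu> = bind_pmf \<mu> (\<lambda>s. map_pmf (\<lambda>a. (s, a)) (joint_policy \<pi> s))"

text \<open>
  Expected discounted return of a reward function \<open>f\<close> from state \<open>s\<close>; the series converges when
  \<open>0 \<le> discount M < 1\<close>, since \<open>f\<close> is bounded on finite types.
\<close>

definition value_fun ::
  "('s1::finite, 's2::finite, 'a1::finite, 'a2::finite) factored_mdp
    \<Rightarrow> ('s1, 's2, 'a1, 'a2) policy \<Rightarrow> ('s1 \<times> 's2 \<Rightarrow> 'a1 \<times> 'a2 \<Rightarrow> real) \<Rightarrow> 's1 \<times> 's2 \<Rightarrow> real" where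
  "value_fun M \<pi> f s =
     (\<Sum>t. discount M ^ t *
        measure_pmf.expectation (add_action \<pi> (state_at M \<pi> (return_pmf s) t)) (\<lambda>(s, a). f s a))"

definition V_ext where
  "V_ext M \<pi> = value_fun M \<pi> (reward M)"

definition V_int2 where
  "V_int2 M \<pi> = value_fun M \<pi> (\<lambda>s a. intrinsic M (snd s) (snd a))"

definition V2 ::
  "('s1::finite, 's2::finite, 'a1::finite, 'a2::finite) factored_mdp
    \<Rightarrow> ('s1, 's2, 'a1, 'a2) policy \<Rightarrow> 's1 \<times> 's2 \<Rightarrow> real" where
  "V2 M \<pi> s = V_ext M \<pi> s + V_int2 M \<pi> s"

definition total_reward2 ::
  "('s1, 's2, 'a1, 'a2) factored_mdp \<Rightarrow> 's1 \<times> 's2 \<Rightarrow> 'a1 \<times> 'a2 \<Rightarrow> real" where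
  "total_reward2 M s a = reward M s a + intrinsic M (snd s) (snd a)"

text \<open>The state-action distribution \<open>p\<^sup>\<pi>(s, a)\<close> induced by \<open>\<pi>\<close>.\<close>

definition sa_law ::
  "('s1, 's2, 'a1, 'a2) factored_mdp \<Rightarrow> ('s1, 's2, 'a1, 'a2) policy
    \<Rightarrow> (('s1 \<times> 's2) \<times> ('a1 \<times> 'a2)) pmf" where
  "sa_law M \<pi> = add_action \<pi> (bind_pmf (sample_time M) (state_at M \<pi> (init M)))"

text \<open>The law of \<open>(s, a, s')\<close> with \<open>(s, a)\<close> drawn from \<open>p\<^sup>\<pi>\<close> and \<open>s'\<close> from \<open>T(\<cdot> | s, a)\<close>.\<close>

definition step_law ::
  "('s1, 's2, 'a1, 'a2) factored_mdp \<Rightarrow> ('s1, 's2, 'a1, 'a2) policy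
    \<Rightarrow> (('s1 \<times> 's2) \<times> ('a1 \<times> 'a2) \<times> ('s1 \<times> 's2)) pmf" where
  "step_law M \<pi> = bind_pmf (sa_law M \<pi>) (\<lambda>(s, a). map_pmf (\<lambda>s'. (s, a, s')) (trans M s a))"

text \<open>\<open>p(s2' | s, a)\<close>\<close>

definition p_next2 ::
  "('s1::finite, 's2, 'a1, 'a2) factored_mdp \<Rightarrow> 's1 \<times> 's2 \<Rightarrow> 'a1 \<times> 'a2 \<Rightarrow> 's2 \<Rightarrow> real" where
  "p_next2 M s a s2' = (\<Sum>s1'\<in>UNIV. pmf (trans M s a) (s1', s2'))"

text \<open>\<open>p\<^sup>\<pi>(s, a, s2')\<close>\<close>

definition p_sa_next2 ::
  "('s1::finite, 's2, 'a1, 'a2) factored_mdp \<Rightarrow> ('s1, 's2, 'a1, 'a2) policy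
    \<Rightarrow> 's1 \<times> 's2 \<Rightarrow> 'a1 \<times> 'a2 \<Rightarrow> 's2 \<Rightarrow> real" where
  "p_sa_next2 M \<pi> s a s2' = pmf (sa_law M \<pi>) (s, a) * p_next2 M s a s2'"

text \<open>
  \<open>p(s1' | s, a, s2')\<close>. This is \<open>0\<close> where the conditioning event has probability \<open>0\<close>. The convention
  matters: in the counterfactual value below, \<open>s2'\<close> may be reachable under the actual
  \<open>(s1, a1)\<close> but unreachable under the resampled \<open>(s1*, a1*)\<close>, and such terms then contribute no
  future value.
\<close>

definition p_next1_given_next2 ::
  "('s1::finite, 's2, 'a1, 'a2) factored_mdp \<Rightarrow> 's1 \<Rightarrow> 's1 \<times> 's2 \<Rightarrow> 'a1 \<times> 'a2 \<Rightarrow> 's2 \<Rightarrow> real" where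
  "p_next1_given_next2 M s1' s a s2' = pmf (trans M s a) (s1', s2') / p_next2 M s a s2'"

text \<open>\<open>p\<^sup>\<pi>(s1, a1 | s2, a2)\<close>\<close>

definition p_cond1 ::
  "('s1::finite, 's2, 'a1::finite, 'a2) factored_mdp \<Rightarrow> ('s1, 's2, 'a1, 'a2) policy
    \<Rightarrow> 's1 \<Rightarrow> 'a1 \<Rightarrow> 's2 \<Rightarrow> 'a2 \<Rightarrow> real" where
  "p_cond1 M \<pi> s1 a1 s2 a2 =
     pmf (sa_law M \<pi>) ((s1, s2), (a1, a2)) /
     (\<Sum>t1\<in>UNIV. \<Sum>b1\<in>UNIV. pmf (sa_law M \<pi>) ((t1, s2), (b1, a2)))"

text \<open>\<open>p\<^sup>\<pi>(s2' | s2, a2)\<close>\<close>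

definition p_next2_marg ::
  "('s1::finite, 's2, 'a1::finite, 'a2) factored_mdp \<Rightarrow> ('s1, 's2, 'a1, 'a2) policy
    \<Rightarrow> 's2 \<Rightarrow> 'a2 \<Rightarrow> 's2 \<Rightarrow> real" where
  "p_next2_marg M \<pi> s2 a2 s2' =
     (\<Sum>t1\<in>UNIV. \<Sum>b1\<in>UNIV. p_cond1 M \<pi> t1 b1 s2 a2 * p_next2 M (t1, s2) (b1, a2) s2')"

definition Q2 ::
  "('s1::finite, 's2::finite, 'a1::finite, 'a2::finite) factored_mdp
    \<Rightarrow> ('s1, 's2, 'a1, 'a2) policy \<Rightarrow> 's1 \<times> 's2 \<Rightarrow> 'a1 \<times> 'a2 \<Rightarrow> 's2 \<Rightarrow> real" where
  "Q2 M \<pi> s a s2' =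
     total_reward2 M s a +
     discount M * (\<Sum>s1'\<in>UNIV. p_next1_given_next2 M s1' s a s2' * V2 M \<pi> (s1', s2'))"

definition Q21_star ::
  "('s1::finite, 's2::finite, 'a1::finite, 'a2::finite) factored_mdp
    \<Rightarrow> ('s1, 's2, 'a1, 'a2) policy \<Rightarrow> 's2 \<Rightarrow> 'a2 \<Rightarrow> 's2 \<Rightarrow> real" where
  "Q21_star M \<pi> s2 a2 s2' =
     (\<Sum>t1\<in>UNIV. \<Sum>b1\<in>UNIV. p_cond1 M \<pi> t1 b1 s2 a2 *
        (total_reward2 M (t1, s2) (b1, a2) +
         discount M *
           (\<Sum>s1'\<in>UNIV. p_next1_given_next2 M s1' (t1, s2) (b1, a2) s2' * V2 M \<pi> (s1', s2'))))"

text \<open>The value of interaction of agent 1 on agent 2.\<close>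

definition VoI21 ::
  "('s1::finite, 's2::finite, 'a1::finite, 'a2::finite) factored_mdp
    \<Rightarrow> ('s1, 's2, 'a1, 'a2) policy \<Rightarrow> real" where
  "VoI21 M \<pi> =
     (\<Sum>s\<in>UNIV. \<Sum>a\<in>UNIV. \<Sum>s2'\<in>UNIV.
        p_sa_next2 M \<pi> s a s2' * (Q2 M \<pi> s a s2' - Q21_star M \<pi> (snd s) (snd a) s2'))"

text \<open>The counterfactual immediate reward.\<close>

definition cf_reward2 ::
  "('s1::finite, 's2, 'a1::finite, 'a2) factored_mdp \<Rightarrow> ('s1, 's2, 'a1, 'a2) policy
    \<Rightarrow> 's2 \<Rightarrow> 'a2 \<Rightarrow> real" where
  "cf_reward2 M \<pi> s2 a2 =
     (\<Sum>t1\<in>UNIV. \<Sum>b1\<in>UNIV. p_cond1 M \<pi> t1 b1 s2 a2 * total_reward2 M (t1, s2) (b1, a2))"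

end

theory Submission
  imports Defs
begin

text \<open>
  Once \<open>p(s1' | s, a, s2')\<close> is integrated out, the two sides differ only in the future-value term:
  there the actual \<open>(s1, a1)\<close> weights \<open>p(s2' | s, a)\<close> and the counterfactual one the value, or vice
  versa. As \<open>p\<^sup>\<pi>(s1, a1 | s2, a2)\<close> is \<open>p\<^sup>\<pi>(s, a)\<close> divided by a quantity free of \<open>(s1, a1)\<close>,
  actual and counterfactual pair are exchangeable and the two terms agree.
\<close>

lemma pmf_step_law:
  "pmf (step_law M \<pi>) (s, a, s') = pmf (sa_law M \<pi>) (s, a) * pmf (trans M s a) s'"
proof -
  \<comment> \<open>The outcome of \<open>step_law\<close> records the pair it was drawn from, so
    every pair other than \<open>(s, a)\<close> contributes mass 0; hence the indicator.\<close>
  have "pmf (step_law M \<pi>) (s, a, s') =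
      measure_pmf.expectation (sa_law M \<pi>)
        (\<lambda>x. indicator {(s, a)} x * pmf (trans M s a) s')"
    unfolding step_law_def pmf_bind
  proof (intro Bochner_Integration.integral_cong refl, clarify)
    fix t1 t2 b1 b2
    have "pmf (map_pmf (\<lambda>s'. (s, a, s')) (trans M s a)) (s, a, s') = pmf (trans M s a) s'"
      by (rule pmf_map_inj') (auto intro: injI)
    moreover have "(s, a, s') \<notin> (\<lambda>s'. ((t1, t2), (b1, b2), s')) ` X"
      if "((t1, t2), (b1, b2)) \<noteq> (s, a)" for X
      using that by auto
    ultimately show "pmf (map_pmf (\<lambda>s'. ((t1, t2), (b1, b2), s')) (trans M (t1, t2) (b1, b2))) (s, a, s') =
        indicator {(s, a)} ((t1, t2), (b1, b2)) * pmf (trans M s a) s'"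
      by (cases "((t1, t2), (b1, b2)) = (s, a)")
        (auto simp: pmf_map_outside)
  qed
  then show ?thesis
    by (simp add: measure_pmf_single)
qed

lemma expectation_step_law:
  fixes M :: "('s1::finite, 's2::finite, 'a1::finite, 'a2::finite) factored_mdp"
    and f :: "_ \<Rightarrow> real"
  shows "measure_pmf.expectation (step_law M \<pi>) f =
    (\<Sum>s\<in>UNIV. \<Sum>a\<in>UNIV. \<Sum>s'\<in>UNIV.
       pmf (sa_law M \<pi>) (s, a) * pmf (trans M s a) s' * f (s, a, s'))"
proof -
  have "measure_pmf.expectation (step_law M \<pi>) f =
      (\<Sum>z\<in>UNIV. pmf (step_law M \<pi>) z * f z)"
    by (subst integral_measure_pmf_real[where A = UNIV]) (auto simp: mult.commute)
  also have "\<dots> = (\<Sum>s\<in>UNIV. \<Sum>a\<in>UNIV. \<Sum>s'\<in>UNIV.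
       pmf (step_law M \<pi>) (s, a, s') * f (s, a, s'))"
    by (simp only: sum.cartesian_product UNIV_Times_UNIV case_prod_unfold prod.collapse)
  finally show ?thesis
    by (simp only: pmf_step_law)
qed

text \<open>The chain rule survives the convention \<open>x / 0 = 0\<close>: if the nonnegative
  masses summed in \<open>p_next2\<close> add up to 0, each of them is 0.\<close>

lemma p_next2_mult_p_next1_given_next2:
  "p_next2 M s a s2' * p_next1_given_next2 M s1' s a s2' = pmf (trans M s a) (s1', s2')"
proof (cases "p_next2 M s a s2' = 0")
  case True
  then have "pmf (trans M s a) (s1', s2') = 0"
    unfolding p_next2_def by (subst (asm) sum_nonneg_eq_0_iff) auto
  with True show ?thesis by simp
qed (simp add: p_next1_given_next2_def)

lemma sum_UNIV_prod:
  "(\<Sum>z\<in>UNIV. f z) = (\<Sum>x\<in>UNIV. \<Sum>y\<in>UNIV. f (x, y))"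
  by (simp add: sum.cartesian_product)

text \<open>\<open>E h\<close> is the \<open>w\<close>-weighted sum of \<open>h\<close> divided by a
  total \<open>D\<close> independent of \<open>h\<close>. Both sides are therefore the product of
  the weighted sums of \<open>f\<close> and \<open>g\<close> over \<open>D\<close>, which is
  symmetric; for \<open>D = 0\<close> both are 0.\<close>

lemma sum_resampled_swap:
  fixes M :: "('s1::finite, 's2::finite, 'a1::finite, 'a2::finite) factored_mdp"
    and \<pi> :: "('s1, 's2, 'a1, 'a2) policy"
    and f g :: "'s1 \<Rightarrow> 'a1 \<Rightarrow> real"
    and s2 :: 's2 and a2 :: 'a2
  defines "w \<equiv> \<lambda>s1 a1. pmf (sa_law M \<pi>) ((s1, s2), (a1, a2))"
    and "E \<equiv> \<lambda>h. \<Sum>t1\<in>UNIV. \<Sum>b1\<in>UNIV. p_cond1 M \<pi> t1 b1 s2 a2 * h t1 b1"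
  shows "(\<Sum>s1\<in>UNIV. \<Sum>a1\<in>UNIV. w s1 a1 * f s1 a1 * E g) =
    (\<Sum>s1\<in>UNIV. \<Sum>a1\<in>UNIV. w s1 a1 * g s1 a1 * E f)"
proof -
  define D where "D = (\<Sum>t1\<in>UNIV. \<Sum>b1\<in>UNIV. w t1 b1)"
  have E: "E h = (\<Sum>t1\<in>UNIV. \<Sum>b1\<in>UNIV. w t1 b1 * h t1 b1) / D" for h
    by (simp add: E_def p_cond1_def w_def D_def sum_divide_distrib)
  show ?thesis
    unfolding E sum_distrib_right[symmetric] by (simp add: mult.commute)
qed

theorem theorem1:
  fixes M :: "('s1::finite, 's2::finite, 'a1::finite, 'a2::finite) factored_mdp"
    and \<pi> :: "('s1, 's2, 'a1, 'a2) policy"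
  assumes "0 \<le> discount M" and "discount M < 1"
  shows "VoI21 M \<pi> =
    measure_pmf.expectation (step_law M \<pi>)
      (\<lambda>((s1, s2), (a1, a2), (s1', s2')).
         total_reward2 M (s1, s2) (a1, a2) - cf_reward2 M \<pi> s2 a2
         + discount M * (1 - p_next2_marg M \<pi> s2 a2 s2' / p_next2 M (s1, s2) (a1, a2) s2')
             * V2 M \<pi> (s1', s2'))"
proof -
  define w where "w s a = pmf (sa_law M \<pi>) (s, a)" for s a
  define q where "q = p_next2 M"
  define pm where "pm = p_next2_marg M \<pi>"
  define d where "d s a = total_reward2 M s a - cf_reward2 M \<pi> (snd s) (snd a)" for s a
  \<comment> \<open>\<open>G\<close> is the mean next value given \<open>s2'\<close>,
    \<open>H\<close> its average over a resampled agent 1, and \<open>X\<close> the summand that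
    both sides of the theorem share.\<close>
  define G where "G s a s2' =
    (\<Sum>s1'\<in>UNIV. p_next1_given_next2 M s1' s a s2' * V2 M \<pi> (s1', s2'))" for s a s2'
  define H where "H s2 a2 s2' =
    (\<Sum>t1\<in>UNIV. \<Sum>b1\<in>UNIV. p_cond1 M \<pi> t1 b1 s2 a2 * G (t1, s2) (b1, a2) s2')" for s2 a2 s2'
  define X where "X s a s2' = w s a * (q s a s2' * (d s a + discount M * G s a s2'))" for s a s2'

  have Q: "Q2 M \<pi> s a s2' - Q21_star M \<pi> (snd s) (snd a) s2' =
      d s a + discount M * (G s a s2' - H (snd s) (snd a) s2')" for s a s2'
    by (simp add: Q2_def Q21_star_def d_def cf_reward2_def H_def flip: G_def)
      (simp add: algebra_simps sum.distrib sum_distrib_left)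
  have lhs: "VoI21 M \<pi> = (\<Sum>s\<in>UNIV. \<Sum>a\<in>UNIV. \<Sum>s2'\<in>UNIV. X s a s2') -
      discount M * (\<Sum>s\<in>UNIV. \<Sum>a\<in>UNIV. \<Sum>s2'\<in>UNIV. w s a * q s a s2' * H (snd s) (snd a) s2')"
    unfolding VoI21_def Q p_sa_next2_def
    by (simp add: X_def w_def q_def sum_distrib_left algebra_simps flip: sum_subtractf)

  \<comment> \<open>The factor \<open>q\<close> cancels the denominator of the ratio. Where
    \<open>q\<close> is 0, all masses on the left vanish, and on the right so does \<open>G\<close>,
    by the default value of \<open>p_next1_given_next2\<close>.\<close>
  have future: "(\<Sum>s1'\<in>UNIV. pmf (trans M s a) (s1', s2') *
        (d s a + discount M * (1 - pm (snd s) (snd a) s2' / q s a s2') * V2 M \<pi> (s1', s2'))) =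
      q s a s2' * (d s a + discount M * G s a s2') - discount M * (pm (snd s) (snd a) s2' * G s a s2')"
    for s a s2'
  proof -
    have "pmf (trans M s a) (s1', s2') *
        (d s a + discount M * (1 - pm (snd s) (snd a) s2' / q s a s2') * V2 M \<pi> (s1', s2')) =
      pmf (trans M s a) (s1', s2') * d s a +
      discount M * (q s a s2' - pm (snd s) (snd a) s2') *
        (p_next1_given_next2 M s1' s a s2' * V2 M \<pi> (s1', s2'))" for s1'
      using p_next2_mult_p_next1_given_next2[of M s a s2' s1']
      by (cases "q s a s2' = 0")
        (auto simp: q_def p_next1_given_next2_def algebra_simps diff_divide_distrib)
    then show ?thesis
      by (simp only: sum.distrib flip: sum_distrib_left sum_distrib_right G_def p_next2_def)
        (simp add: q_def algebra_simps)
  qed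
  have "measure_pmf.expectation (step_law M \<pi>)
      (\<lambda>((s1, s2), (a1, a2), (s1', s2')).
         total_reward2 M (s1, s2) (a1, a2) - cf_reward2 M \<pi> s2 a2
         + discount M * (1 - p_next2_marg M \<pi> s2 a2 s2' / p_next2 M (s1, s2) (a1, a2) s2')
             * V2 M \<pi> (s1', s2')) =
    (\<Sum>s\<in>UNIV. \<Sum>a\<in>UNIV. \<Sum>s2'\<in>UNIV. w s a * (\<Sum>s1'\<in>UNIV. pmf (trans M s a) (s1', s2') *
        (d s a + discount M * (1 - pm (snd s) (snd a) s2' / q s a s2') * V2 M \<pi> (s1', s2'))))"
    unfolding expectation_step_law
  proof (intro sum.cong refl, goal_cases)
    case (1 s a)
    show ?case
      \<comment> \<open>Splitting \<open>s'\<close> and moving \<open>s2'\<close> outside leaves the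
        sum over \<open>s1'\<close> innermost, as \<open>future\<close> needs it.\<close>
      by (subst sum_UNIV_prod, subst sum.swap)
        (simp add: w_def d_def pm_def q_def sum_distrib_left mult.assoc split_beta)
  qed
  also have "\<dots> = (\<Sum>s\<in>UNIV. \<Sum>a\<in>UNIV. \<Sum>s2'\<in>UNIV. X s a s2') -
      discount M * (\<Sum>s\<in>UNIV. \<Sum>a\<in>UNIV. \<Sum>s2'\<in>UNIV. w s a * G s a s2' * pm (snd s) (snd a) s2')"
    unfolding future
    by (simp add: X_def sum_distrib_left right_diff_distrib mult_ac flip: sum_subtractf)
  also have "(\<Sum>s\<in>UNIV. \<Sum>a\<in>UNIV. \<Sum>s2'\<in>UNIV. w s a * G s a s2' * pm (snd s) (snd a) s2') =
      (\<Sum>s\<in>UNIV. \<Sum>a\<in>UNIV. \<Sum>s2'\<in>UNIV. w s a * q s a s2' * H (snd s) (snd a) s2')"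
  proof -
    \<comment> \<open>The exchange argument works with \<open>s2\<close>, \<open>a2\<close> and
      \<open>s2'\<close> fixed, so the sums over agent 1 must come last.\<close>
    have agent2_outermost: "(\<Sum>s\<in>UNIV. \<Sum>a\<in>UNIV. \<Sum>s2'\<in>UNIV. F s a s2') =
        (\<Sum>s2\<in>UNIV. \<Sum>a2\<in>UNIV. \<Sum>s2'\<in>UNIV. \<Sum>s1\<in>UNIV. \<Sum>a1\<in>UNIV. F (s1, s2) (a1, a2) s2')"
      for F :: "'s1 \<times> 's2 \<Rightarrow> 'a1 \<times> 'a2 \<Rightarrow> 's2 \<Rightarrow> real"
    proof -
      have "(\<Sum>s\<in>UNIV. \<Sum>a\<in>UNIV. \<Sum>s2'\<in>UNIV. F s a s2') =
        (\<Sum>(s1, s2, a1, a2, s2')\<in>UNIV. F (s1, s2) (a1, a2) s2')"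
        by (simp add: sum_UNIV_prod)
      also have "\<dots> = (\<Sum>(s2, a2, s2', s1, a1)\<in>UNIV. F (s1, s2) (a1, a2) s2')"
        by (rule sum.reindex_bij_witness[of _ "\<lambda>(s2, a2, s2', s1, a1). (s1, s2, a1, a2, s2')"
              "\<lambda>(s1, s2, a1, a2, s2'). (s2, a2, s2', s1, a1)"]) auto
      finally show ?thesis
        by (simp add: sum_UNIV_prod)
    qed
    show ?thesis
      unfolding agent2_outermost snd_conv w_def q_def pm_def H_def p_next2_marg_def
      \<comment> \<open>Here \<open>f\<close> is \<open>G\<close> and \<open>g\<close> is
        \<open>p_next2\<close>, whose resampled averages are \<open>H\<close> and
        \<open>p_next2_marg\<close>.\<close>
      by (intro sum.cong refl sum_resampled_swap)
  qed
  finally show ?thesis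
    using lhs by simp
qed

end
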